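(* There exist infinitely many pairwise non-isomorphic graphs $G$ that contain $K_{3,3}$ as a subgraph and satisfy $\mathrm{mad}(G)=3$, $\Delta(G)=4$, and $\mathrm{lc}(G)>\lceil\Delta(G)/2\rceil+2$.
   Context: Graphs are finite and simple; $\Delta(G)$ is the maximum degree. A linear coloring of $G$ is a proper vertex coloring such that the subgraph induced by the union of each pair of color classes is a linear forest, i.e. a disjoint union of paths (a single vertex counts as a path). The linear chromatic number $\mathrm{lc}(G)$ is the smallest $k$ such that $G$ has a linear coloring with $k$ colors. The maximum average degree is $\mathrm{mad}(G)=\max_{H\subseteq G}\frac{2|E(H)|}{|V(H)|}$, over all nonempty subgraphs $H$ of $G$. *)

theory Defs
  imports Complex_Main
begin

record 'a graph =
  verts :: "'a set"
  edges :: "'a set set"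

definition simple_graph :: "'a graph \<Rightarrow> bool" where
  "simple_graph G \<longleftrightarrow>
     finite (verts G) \<and> (\<forall>e \<in> edges G. e \<subseteq> verts G \<and> card e = 2)"

definition degree :: "'a graph \<Rightarrow> 'a \<Rightarrow> nat" where
  "degree G v = card {e \<in> edges G. v \<in> e}"

definition max_degree :: "'a graph \<Rightarrow> nat" where
  "max_degree G = Max (degree G ` verts G)"

definition subgraph :: "'a graph \<Rightarrow> 'a graph \<Rightarrow> bool" where
  "subgraph H G \<longleftrightarrow>
     simple_graph H \<and> verts H \<subseteq> verts G \<and> edges H \<subseteq> edges G"

definition induced_subgraph :: "'a graph \<Rightarrow> 'a set \<Rightarrow> 'a graph" where
  "induced_subgraph G S = \<lparr>verts = verts G \<inter> S, edges = {e \<in> edges G. e \<subseteq> S}\<rparr>"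

definition isomorphic :: "'a graph \<Rightarrow> 'b graph \<Rightarrow> bool" where
  "isomorphic G H \<longleftrightarrow>
     (\<exists>f. bij_betw f (verts G) (verts H) \<and>
          (\<forall>u \<in> verts G. \<forall>v \<in> verts G. {u, v} \<in> edges G \<longleftrightarrow> {f u, f v} \<in> edges H))"

definition complete_bipartite :: "nat \<Rightarrow> nat \<Rightarrow> nat graph" where
  "complete_bipartite m n =
     \<lparr>verts = {..<m + n}, edges = {{i, j} | i j. i < m \<and> m \<le> j \<and> j < m + n}\<rparr>"

definition contains_subgraph :: "'a graph \<Rightarrow> 'b graph \<Rightarrow> bool" where
  "contains_subgraph G K \<longleftrightarrow> (\<exists>H. subgraph H G \<and> isomorphic H K)"

definition mad :: "'a graph \<Rightarrow> real" where
  "mad G = Max {2 * real (card (edges H)) / real (card (verts H)) | H.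
                  subgraph H G \<and> verts H \<noteq> {}}"

definition path_graph :: "'a graph \<Rightarrow> bool" where
  "path_graph G \<longleftrightarrow>
     (\<exists>xs. xs \<noteq> [] \<and> distinct xs \<and> verts G = set xs \<and>
           edges G = {{xs ! i, xs ! Suc i} | i. Suc i < length xs})"

text \<open>The family \<open>P\<close> of paths may be empty, so the graph without vertices is a linear
  forest. This matters for colorings that leave a color unused.\<close>

definition linear_forest :: "'a graph \<Rightarrow> bool" where
  "linear_forest G \<longleftrightarrow>
     (\<exists>P. (\<forall>H \<in> P. path_graph H) \<and>
          pairwise (\<lambda>H K. verts H \<inter> verts K = {}) P \<and>
          verts G = (\<Union>H \<in> P. verts H) \<and> edges G = (\<Union>H \<in> P. edges H))"

definition proper_coloring :: "'a graph \<Rightarrow> nat \<Rightarrow> ('a \<Rightarrow> nat) \<Rightarrow> bool" where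
  "proper_coloring G k c \<longleftrightarrow>
     (\<forall>v \<in> verts G. c v < k) \<and> (\<forall>u v. {u, v} \<in> edges G \<longrightarrow> c u \<noteq> c v)"

definition color_class :: "'a graph \<Rightarrow> ('a \<Rightarrow> nat) \<Rightarrow> nat \<Rightarrow> 'a set" where
  "color_class G c i = {v \<in> verts G. c v = i}"

definition linear_coloring :: "'a graph \<Rightarrow> nat \<Rightarrow> ('a \<Rightarrow> nat) \<Rightarrow> bool" where
  "linear_coloring G k c \<longleftrightarrow>
     proper_coloring G k c \<and>
     (\<forall>i < k. \<forall>j < k. i \<noteq> j \<longrightarrow>
        linear_forest (induced_subgraph G (color_class G c i \<union> color_class G c j)))"

definition lc :: "'a graph \<Rightarrow> nat" where
  "lc G = (LEAST k. \<exists>c. linear_coloring G k c)"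

end

(* In a linear coloring no three neighbours of a vertex share a color, and a 4-cycle uses at
   least three colors. Hence each side of K_{3,3} receives at least two colors and one of the
   sides receives three; the two sides share no color, so every graph containing K_{3,3} needs
   at least five colors. It remains to raise the maximum degree to 4 without raising the maximum
   average degree above 3: attach a pendant edge to K_{3,3}. Isolated vertices give infinitely
   many examples. *)
theory Submission
  imports Defs
begin

section \<open>Positions of vertices along the paths of a linear forest\<close>

lemma path_graph_position:
  assumes "path_graph H"
  obtains pos :: "'a \<Rightarrow> nat" where "inj_on pos (verts H)"
    "\<And>u v. {u, v} \<in> edges H \<Longrightarrow>
       u \<in> verts H \<and> v \<in> verts H \<and> (pos v = Suc (pos u) \<or> pos u = Suc (pos v))"
proof -
  obtain xs where xs: "distinct xs" "verts H = set xs"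
      "edges H = {{xs ! i, xs ! Suc i} | i. Suc i < length xs}"
    using assms unfolding path_graph_def by blast
  \<comment> \<open>The index of a vertex in the list. Distinctness of \<open>xs\<close> makes it
    well defined and injective, and consecutive entries get consecutive values.\<close>
  define pos where "pos = the_inv_into {..<length xs} ((!) xs)"
  have inj: "inj_on ((!) xs) {..<length xs}"
    using xs(1) by (simp add: inj_on_nth)
  have pos: "pos (xs ! i) = i" if "i < length xs" for i
    unfolding pos_def using inj that by (simp add: the_inv_into_f_f)
  show thesis
  proof (rule that)
    show "inj_on pos (verts H)"
      by (rule inj_onI) (metis pos xs(2) in_set_conv_nth)
    fix u v assume "{u, v} \<in> edges H"
    then obtain i where i: "Suc i < length xs" "{u, v} = {xs ! i, xs ! Suc i}"
      using xs(3) by auto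
    then have "u = xs ! i \<and> v = xs ! Suc i \<or> u = xs ! Suc i \<and> v = xs ! i"
      by (auto simp: doubleton_eq_iff)
    then show "u \<in> verts H \<and> v \<in> verts H \<and> (pos v = Suc (pos u) \<or> pos u = Suc (pos v))"
      using i(1) pos xs(2) by (auto simp: Suc_lessD)
  qed
qed

text \<open>\<open>S\<close> is the vertex set of the path through \<open>a\<close>. Its closure
  under adjacency comes from disjointness of the paths. With this lemma, excluding a subgraph from a
  linear forest becomes arithmetic on positions.\<close>

lemma linear_forest_position:
  assumes "linear_forest G" "a \<in> verts G"
  obtains S and pos :: "'a \<Rightarrow> nat" where "a \<in> S" "inj_on pos S"
    "\<And>u v. {u, v} \<in> edges G \<Longrightarrow> u \<in> S \<Longrightarrow>
       v \<in> S \<and> (pos v = Suc (pos u) \<or> pos u = Suc (pos v))"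
proof -
  obtain P where P: "\<And>H. H \<in> P \<Longrightarrow> path_graph H"
      "pairwise (\<lambda>H K. verts H \<inter> verts K = {}) P"
      "verts G = (\<Union>H \<in> P. verts H)" "edges G = (\<Union>H \<in> P. edges H)"
    using assms(1) unfolding linear_forest_def
    by (elim exE conjE) (rule that, erule (1) bspec, assumption+)
  obtain H where H: "H \<in> P" "a \<in> verts H" using assms(2) P(3) by auto
  obtain pos :: "'a \<Rightarrow> nat" where pos: "inj_on pos (verts H)"
    "\<And>u v. {u, v} \<in> edges H \<Longrightarrow>
       u \<in> verts H \<and> v \<in> verts H \<and> (pos v = Suc (pos u) \<or> pos u = Suc (pos v))"
    using path_graph_position[OF P(1)[OF H(1)]] by blast
  show thesis
  proof (rule that[OF H(2) pos(1)])
    fix u v assume e: "{u, v} \<in> edges G" and u: "u \<in> verts H"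
    obtain K where K: "K \<in> P" "{u, v} \<in> edges K" using e P(4) by auto
    \<comment> \<open>The path \<open>K\<close> supplying the edge meets \<open>H\<close> in
      \<open>u\<close>, and distinct members of \<open>P\<close> are disjoint.\<close>
    have "u \<in> verts K" using path_graph_position[OF P(1)[OF K(1)]] K(2) by metis
    then have "K = H" using P(2) H(1) K(1) u unfolding pairwise_def by blast
    then show "v \<in> verts H \<and> (pos v = Suc (pos u) \<or> pos u = Suc (pos v))"
      using pos(2) K(2) by blast
  qed
qed

text \<open>Every neighbour of \<open>a\<close> sits at \<open>pos a + 1\<close> or
  \<open>pos a - 1\<close>, so two of any three share a position and coincide by
  injectivity.\<close>

lemma linear_forest_no_claw:
  assumes "linear_forest G" "a \<in> verts G"
    and "{a, x} \<in> edges G" "{a, y} \<in> edges G" "{a, z} \<in> edges G"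
  shows "x = y \<or> x = z \<or> y = z"
proof -
  obtain S and pos :: "'a \<Rightarrow> nat" where S: "a \<in> S" "inj_on pos S"
    "\<And>u v. {u, v} \<in> edges G \<Longrightarrow> u \<in> S \<Longrightarrow>
       v \<in> S \<and> (pos v = Suc (pos u) \<or> pos u = Suc (pos v))"
    using linear_forest_position[OF assms(1,2)] by blast
  have "pos x = pos y \<or> pos x = pos z \<or> pos y = pos z"
    using S(1,3) assms(3-) by (metis nat.inject)
  then show ?thesis using S assms(3-) by (meson inj_onD)
qed

text \<open>If \<open>b\<close> and \<open>b'\<close> have different positions, both adjacent to
  \<open>pos a\<close>, then \<open>pos a\<close> is their midpoint; the same holds for
  \<open>pos a'\<close>, so the two agree.\<close>

lemma linear_forest_no_four_cycle:
  assumes "linear_forest G" "a \<in> verts G"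
    and "{a, b} \<in> edges G" "{a, b'} \<in> edges G" "{a', b} \<in> edges G" "{a', b'} \<in> edges G"
  shows "a = a' \<or> b = b'"
proof -
  obtain S and pos :: "'a \<Rightarrow> nat" where S: "a \<in> S" "inj_on pos S"
    "\<And>u v. {u, v} \<in> edges G \<Longrightarrow> u \<in> S \<Longrightarrow>
       v \<in> S \<and> (pos v = Suc (pos u) \<or> pos u = Suc (pos v))"
    using linear_forest_position[OF assms(1,2)] by blast
  have b: "b \<in> S" "b' \<in> S" using S(1,3) assms(3,4) by blast+
  have a': "a' \<in> S" using S(3)[of b a'] b assms(5) by (simp add: insert_commute)
  have "pos a = pos a' \<or> pos b = pos b'"
    using S(3)[OF assms(3) S(1)] S(3)[OF assms(4) S(1)] S(3)[OF assms(5) a'] S(3)[OF assms(6) a']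
    by linarith
  then show ?thesis using S(1,2) b a' by (meson inj_onD)
qed

section \<open>Forbidden color patterns in linear colorings\<close>

lemma linear_coloring_bicolored:
  assumes "linear_coloring G k c" "a \<in> verts G" "b \<in> verts G" "{a, b} \<in> edges G"
  defines "K \<equiv> induced_subgraph G (color_class G c (c a) \<union> color_class G c (c b))"
  shows "linear_forest K" "a \<in> verts K"
    and "\<And>x y. \<lbrakk>{x, y} \<in> edges G; x \<in> verts G; y \<in> verts G; c x \<in> {c a, c b}; c y \<in> {c a, c b}\<rbrakk>
           \<Longrightarrow> {x, y} \<in> edges K"
proof -
  \<comment> \<open>Properness along the edge \<open>{a, b}\<close> gives two distinct colors, as
    the linear forest condition demands.\<close>
  have "c a < k" "c b < k" "c a \<noteq> c b"
    using assms unfolding linear_coloring_def proper_coloring_def by blast+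
  then show "linear_forest K"
    using assms(1) unfolding K_def linear_coloring_def by blast
qed (use assms(2) in \<open>auto simp: K_def induced_subgraph_def color_class_def\<close>)

text \<open>Otherwise the whole claw centered at \<open>a\<close> would lie in the linear forest
  spanned by the colors of \<open>a\<close> and \<open>x\<close>.\<close>

lemma linear_coloring_no_monochromatic_claw:
  assumes lin: "linear_coloring G k c" and V: "{a, x, y, z} \<subseteq> verts G"
    and E: "{a, x} \<in> edges G" "{a, y} \<in> edges G" "{a, z} \<in> edges G"
    and "x \<noteq> y" "x \<noteq> z" "y \<noteq> z"
  shows "\<not> (c x = c y \<and> c x = c z)"
proof
  assume eq: "c x = c y \<and> c x = c z"
  note K = linear_coloring_bicolored[OF lin, of a x]
  have "x = y \<or> x = z \<or> y = z"
    by (rule linear_forest_no_claw[OF K(1,2)]) (use V E eq K(3) in auto)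
  then show False using assms by blast
qed

lemma linear_coloring_no_bicolored_four_cycle:
  assumes lin: "linear_coloring G k c" and V: "{a, a', b, b'} \<subseteq> verts G"
    and E: "{a, b} \<in> edges G" "{a, b'} \<in> edges G" "{a', b} \<in> edges G" "{a', b'} \<in> edges G"
    and "a \<noteq> a'" "b \<noteq> b'"
  shows "\<not> (c a = c a' \<and> c b = c b')"
proof
  assume eq: "c a = c a' \<and> c b = c b'"
  note K = linear_coloring_bicolored[OF lin, of a b]
  have "a = a' \<or> b = b'"
    by (rule linear_forest_no_four_cycle[OF K(1,2)]) (use V E eq K(3) in auto)
  then show False using assms by blast
qed

text \<open>The common neighbour \<open>a\<close> is the center of a claw with leaf set
  \<open>B\<close>, so \<open>c\<close> is not constant on \<open>B\<close>.\<close>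

lemma linear_coloring_side_two_colors:
  assumes lin: "linear_coloring G k c" and V: "insert a B \<subseteq> verts G" "card B = 3"
    and E: "\<And>b. b \<in> B \<Longrightarrow> {a, b} \<in> edges G"
  shows "2 \<le> card (c ` B)"
proof -
  obtain x y z where B: "B = {x, y, z}" "x \<noteq> y" "x \<noteq> z" "y \<noteq> z"
    using V(2) by (auto simp: card_3_iff)
  have "\<not> (c x = c y \<and> c x = c z)"
    by (rule linear_coloring_no_monochromatic_claw[OF lin, of a]) (use V E B in auto)
  then consider "c x \<noteq> c y" | "c x \<noteq> c z" by blast
  then show ?thesis
  proof cases
    case 1
    have "card {c x, c y} \<le> card (c ` B)" by (rule card_mono) (auto simp: B)
    then show ?thesis using 1 by simp
  next
    case 2
    have "card {c x, c z} \<le> card (c ` B)" by (rule card_mono) (auto simp: B)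
    then show ?thesis using 2 by simp
  qed
qed

lemma linear_coloring_K33_ge_5:
  assumes lin: "linear_coloring G k c" and V: "A \<union> B \<subseteq> verts G"
    and card: "card A = 3" "card B = 3"
    and E: "\<And>a b. a \<in> A \<Longrightarrow> b \<in> B \<Longrightarrow> {a, b} \<in> edges G"
  shows "5 \<le> k"
proof -
  have fin: "finite A" "finite B" using card by (auto intro: card_ge_0_finite)
  obtain a b where ab: "a \<in> A" "b \<in> B" using card by fastforce
  have A2: "2 \<le> card (c ` A)"
    by (rule linear_coloring_side_two_colors[OF lin, of b])
       (use V card E ab in \<open>auto simp: insert_commute\<close>)
  have B2: "2 \<le> card (c ` B)"
    by (rule linear_coloring_side_two_colors[OF lin, of a]) (use V card E ab in auto)
  \<comment> \<open>A repeated color on each side would give two equally colored pairs, which form a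
    bicolored 4-cycle because the sides are completely joined.\<close>
  have "inj_on c A \<or> inj_on c B"
  proof (rule ccontr)
    assume "\<not> (inj_on c A \<or> inj_on c B)"
    then obtain x x' y y' where xy: "x \<in> A" "x' \<in> A" "y \<in> B" "y' \<in> B"
        "x \<noteq> x'" "y \<noteq> y'" "c x = c x'" "c y = c y'"
      unfolding inj_on_def by blast
    have "\<not> (c x = c x' \<and> c y = c y')"
      by (rule linear_coloring_no_bicolored_four_cycle[OF lin]) (use V E xy in auto)
    then show False using xy by blast
  qed
  then have "card (c ` A) = 3 \<or> card (c ` B) = 3" using card by (auto simp: card_image)
  \<comment> \<open>Each vertex of \<open>A\<close> is adjacent to each vertex of \<open>B\<close>,
    so the color counts of the sides add up: at least 3 + 2.\<close>
  moreover have "c ` A \<inter> c ` B = {}"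
    using lin E unfolding linear_coloring_def proper_coloring_def by blast
  then have "card (c ` A \<union> c ` B) = card (c ` A) + card (c ` B)"
    using fin by (simp add: card_Un_disjoint)
  moreover have "c ` A \<union> c ` B \<subseteq> {..<k}"
    using lin V unfolding linear_coloring_def proper_coloring_def by auto
  then have "card (c ` A \<union> c ` B) \<le> k"
    by (metis card_lessThan card_mono finite_lessThan)
  ultimately show ?thesis using A2 B2 by linarith
qed

section \<open>Tools for evaluating \<open>lc\<close> and \<open>mad\<close>\<close>

lemma linear_forest_two_vertices:
  assumes "verts G = {i, j}" "i \<noteq> j" "edges G \<subseteq> {{i, j}}"
  shows "linear_forest G"
proof (cases "edges G = {}")
  case True
  have "path_graph \<lparr>verts = {v}, edges = {}\<rparr>" for v :: 'a
    unfolding path_graph_def by (rule exI[of _ "[v]"]) simp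
  then show ?thesis
    unfolding linear_forest_def
    by (intro exI[of _ "{\<lparr>verts = {i}, edges = {}\<rparr>, \<lparr>verts = {j}, edges = {}\<rparr>}"])
       (use assms True in \<open>auto simp: pairwise_def\<close>)
next
  case False
  then have "edges G = {{i, j}}" using assms(3) by blast
  then have "path_graph G"
    unfolding path_graph_def using assms by (intro exI[of _ "[i, j]"]) auto
  then show ?thesis
    unfolding linear_forest_def by (intro exI[of _ "{G}"]) auto
qed

text \<open>Ensures that the \<open>LEAST\<close> in \<open>lc\<close> ranges over a nonempty set.
  All color classes are singletons, so any two of them induce a graph on two vertices: one edge or
  two isolated points.\<close>

lemma linear_coloring_id:
  fixes G :: "nat graph"
  assumes "simple_graph G" "verts G = {..<N}"
  shows "linear_coloring G N id"
proof -
  have "u \<noteq> v" if "{u, v} \<in> edges G" for u v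
    using that assms(1) unfolding simple_graph_def by fastforce
  moreover have "linear_forest (induced_subgraph G (color_class G id i \<union> color_class G id j))"
    if "i < N" "j < N" "i \<noteq> j" for i j
  proof (rule linear_forest_two_vertices[OF _ that(3)])
    have cl: "color_class G id i \<union> color_class G id j = {i, j}"
      using that assms(2) by (auto simp: color_class_def)
    show "verts (induced_subgraph G (color_class G id i \<union> color_class G id j)) = {i, j}"
      unfolding cl using that assms(2) by (auto simp: induced_subgraph_def)
    have "e = {i, j}" if "e \<in> edges G" "e \<subseteq> {i, j}" for e
      using that \<open>i \<noteq> j\<close> assms(1) unfolding simple_graph_def
      by (intro card_subset_eq) auto
    then show "edges (induced_subgraph G (color_class G id i \<union> color_class G id j)) \<subseteq> {{i, j}}"
      unfolding cl by (auto simp: induced_subgraph_def)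
  qed
  ultimately show ?thesis
    using assms(2) unfolding linear_coloring_def proper_coloring_def by auto
qed

text \<open>\<open>LEAST\<close> is only known to satisfy its predicate when some number does; hence
  a witness coloring is required besides the lower bound.\<close>

lemma lc_ge:
  assumes "linear_coloring G k c" "\<And>k c. linear_coloring G k c \<Longrightarrow> m \<le> k"
  shows "m \<le> lc G"
  unfolding lc_def by (rule LeastI2_ex) (use assms in blast)+

text \<open>Clearing denominators leaves a counting inequality for every subgraph, the empty one
  included; \<open>H0\<close> attains the bound.\<close>

lemma mad_eqI:
  assumes fin: "finite (verts G)" "finite (edges G)"
    and le: "\<And>H. subgraph H G \<Longrightarrow> 2 * real (card (edges H)) \<le> d * real (card (verts H))"
    and eq: "subgraph H0 G" "verts H0 \<noteq> {}" "2 * real (card (edges H0)) = d * real (card (verts H0))"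
  shows "mad G = d"
proof -
  let ?S = "{2 * real (card (edges H)) / real (card (verts H)) | H. subgraph H G \<and> verts H \<noteq> {}}"
  have pos: "0 < real (card (verts H))" if "subgraph H G" "verts H \<noteq> {}" for H
    using that by (simp add: subgraph_def simple_graph_def card_gt_0_iff)
  \<comment> \<open>\<open>Max\<close> needs a finite set: a density depends only on the vertex set
    and the edge set, and there are finitely many choices for each.\<close>
  have "?S \<subseteq> (\<lambda>(V, E). 2 * real (card E) / real (card V)) ` (Pow (verts G) \<times> Pow (edges G))"
    by (force simp: subgraph_def image_iff)
  then have "finite ?S" using fin finite_subset by fastforce
  moreover have "x \<le> d" if "x \<in> ?S" for x
    proof -
    obtain H where H: "x = 2 * real (card (edges H)) / real (card (verts H))"
        "subgraph H G" "verts H \<noteq> {}"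
      using \<open>x \<in> ?S\<close> by blast
    show ?thesis unfolding H(1) using le[OF H(2)] pos[OF H(2,3)] by (simp only: pos_divide_le_eq)
  qed
  moreover have "d = 2 * real (card (edges H0)) / real (card (verts H0))"
    using eq pos[OF eq(1,2)] by (simp add: field_simps)
  then have "d \<in> ?S" using eq by blast
  ultimately show ?thesis unfolding mad_def by (intro Max_eqI)
qed

section \<open>The family: K_{3,3} with a pendant edge and isolated vertices\<close>

lemma isomorphic_refl: "isomorphic G G"
  unfolding isomorphic_def by (rule exI[of _ id]) simp

lemma isomorphic_card_verts: "isomorphic G H \<Longrightarrow> card (verts G) = card (verts H)"
  unfolding isomorphic_def by (auto dest: bij_betw_same_card)

text \<open>The sides of K_{3,3} are \<open>{0, 1, 2}\<close> and \<open>{3, 4, 5}\<close>;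
  \<open>6\<close> is the leaf hanging from \<open>0\<close>, and the other \<open>n\<close>
  vertices are isolated.\<close>

definition K33_pendant :: "nat \<Rightarrow> nat graph" where
  "K33_pendant n =
     \<lparr>verts = {..<7 + n}, edges = insert {0, 6} (edges (complete_bipartite 3 3))\<rparr>"

lemma edges_K33: "edges (complete_bipartite 3 3) = (\<lambda>(i, j). {i, j}) ` ({0, 1, 2} \<times> {3, 4, 5})"
proof -
  have "edges (complete_bipartite 3 3) = (\<lambda>(i, j). {i, j}) ` ({..<3} \<times> {3..<6})"
    by (auto simp: complete_bipartite_def image_iff) blast
  moreover have "{..<3} = {0, 1, 2 :: nat}" "{3..<6} = {3, 4, 5 :: nat}" by auto
  ultimately show ?thesis by simp
qed

lemma card_edges_K33: "card (edges (complete_bipartite 3 3)) = 9"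
proof -
  \<comment> \<open>The sides are disjoint, so an unordered pair determines which endpoint is
    \<open>i\<close>; the count is then 3 * 3.\<close>
  have "inj_on (\<lambda>(i, j). {i, j}) ({0, 1, 2} \<times> {3, 4, 5 :: nat})"
    by (auto simp: inj_on_def doubleton_eq_iff)
  then show ?thesis unfolding edges_K33 by (simp add: card_image)
qed

lemma simple_K33: "simple_graph (complete_bipartite 3 3)"
  unfolding simple_graph_def edges_K33 by (auto simp: complete_bipartite_def)

lemma subgraph_K33_pendant: "subgraph (complete_bipartite 3 3) (K33_pendant n)"
  using simple_K33 by (auto simp: subgraph_def K33_pendant_def complete_bipartite_def)

lemma simple_K33_pendant: "simple_graph (K33_pendant n)"
  unfolding simple_graph_def K33_pendant_def edges_K33 by auto

section \<open>Maximum degree, density and linear chromatic number of the family\<close>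

lemma max_degree_K33_pendant: "max_degree (K33_pendant n) = 4"
proof -
  have deg: "degree (K33_pendant n) v \<le> 4" for v
  proof -
    \<comment> \<open>\<open>N\<close> is a set of candidate neighbours of \<open>v\<close>; mapping
      each \<open>w\<close> to \<open>{v, w}\<close> covers all incident edges, so the degree is at
      most \<open>card N\<close>.\<close>
    have "\<exists>N. finite N \<and> card N \<le> 4 \<and>
        {e \<in> edges (K33_pendant n). v \<in> e} \<subseteq> (\<lambda>w. {v, w}) ` N"
    proof -
      consider "v = 0" | "v \<in> {1, 2}" | "v \<in> {3, 4, 5}" | "v \<ge> 6" by fastforce
      then show ?thesis
      proof cases
        case 1
        then show ?thesis
          by (intro exI[of _ "{3, 4, 5, 6}"]) (auto simp: K33_pendant_def edges_K33)
      next
        case 2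
        then show ?thesis
          by (intro exI[of _ "{3, 4, 5}"]) (auto simp: K33_pendant_def edges_K33)
      next
        case 3
        \<comment> \<open>Here \<open>v\<close> is the second component of the pair, which has to be
          turned around.\<close>
        have "e \<in> (\<lambda>w. {v, w}) ` {0, 1, 2}" if e: "e \<in> edges (K33_pendant n)" "v \<in> e" for e
        proof -
          have "e \<noteq> {0, 6}" using e(2) 3 by auto
          then obtain i j where ij: "e = {i, j}" "i \<in> {0, 1, 2}" "j \<in> {3, 4, 5}"
            using e(1) unfolding K33_pendant_def edges_K33 by auto
          then have "v = j" using e(2) 3 by auto
          then have "e = {v, i}" using ij(1) by (simp add: insert_commute)
          then show ?thesis using ij(2) by blast
        qed
        then show ?thesis
          by (intro exI[of _ "{0, 1, 2}"]) (auto simp: card_insert_if)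
      next
        case 4
        \<comment> \<open>For \<open>v = 6\<close> this is the pendant edge; for larger
          \<open>v\<close> no edge is incident.\<close>
        then have "{e \<in> edges (K33_pendant n). v \<in> e} \<subseteq> {{v, 0}}"
          by (auto simp: K33_pendant_def edges_K33)
        then show ?thesis by (intro exI[of _ "{0}"]) simp
      qed
    qed
    then obtain N where N: "finite N" "card N \<le> 4"
        "{e \<in> edges (K33_pendant n). v \<in> e} \<subseteq> (\<lambda>w. {v, w}) ` N"
      by blast
    then show ?thesis unfolding degree_def by (meson le_trans surj_card_le)
  qed
  have "edges (K33_pendant n) = {{0, 6}, {2, 5}, {2, 4}, {2, 3},
      {1, 5}, {1, 4}, {1, 3}, {0, 5}, {0, 4}, {0, 3}}"
    by (simp add: K33_pendant_def edges_K33 Sigma_def)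
  \<comment> \<open>The bound 4 is attained at \<open>0\<close>, which has three neighbours across
    K_{3,3} and the leaf.\<close>
  then have "{{0, 3}, {0, 4}, {0, 5}, {0, 6}} \<subseteq> {e \<in> edges (K33_pendant n). 0 \<in> e}"
    by simp
  moreover have "finite (edges (K33_pendant n))"
    by (simp add: K33_pendant_def edges_K33)
  ultimately have "card {{0, 3}, {0, 4}, {0, 5}, {0, 6 :: nat}} \<le> degree (K33_pendant n) 0"
    unfolding degree_def by (intro card_mono) auto
  then have "degree (K33_pendant n) 0 = 4"
    using deg[of 0] by (simp add: doubleton_eq_iff)
  moreover have "0 \<in> verts (K33_pendant n)" by (simp add: K33_pendant_def)
  ultimately have "4 \<in> degree (K33_pendant n) ` verts (K33_pendant n)" by (metis imageI)
  then show ?thesis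
    unfolding max_degree_def using deg simple_K33_pendant
    by (intro Max_eqI) (auto simp: simple_graph_def)
qed

lemma mad_K33_pendant: "mad (K33_pendant n) = 3"
proof (rule mad_eqI)
  show "finite (verts (K33_pendant n))" "finite (edges (K33_pendant n))"
    by (auto simp: K33_pendant_def edges_K33)
  show "subgraph (complete_bipartite 3 3) (K33_pendant n)" by (rule subgraph_K33_pendant)
  show "verts (complete_bipartite 3 3) \<noteq> {}"
    by (simp add: complete_bipartite_def lessThan_empty_iff)
  \<comment> \<open>K_{3,3} itself attains density 3, since 2 * 9 = 3 * 6.\<close>
  have "card (verts (complete_bipartite 3 3)) = 6" by (simp add: complete_bipartite_def)
  then show "2 * real (card (edges (complete_bipartite 3 3)))
      = 3 * real (card (verts (complete_bipartite 3 3)))"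
    by (simp add: card_edges_K33)
next
  fix H assume H: "subgraph H (K33_pendant n)"
  \<comment> \<open>With a, b, c the sizes of \<open>A\<close>, \<open>B\<close>, \<open>C\<close>,
    the subgraph \<open>H\<close> has at most ab + c edges: the leaf pays for the pendant edge, and
    isolated vertices only lower the density.\<close>
  define A where "A = verts H \<inter> {0, 1, 2}"
  define B where "B = verts H \<inter> {3, 4, 5}"
  define C where "C = verts H \<inter> {6}"
  have A: "finite A" "card A \<le> 3" and B: "finite B" "card B \<le> 3" and C: "finite C"
    using card_mono[of "{0, 1, 2 :: nat}" A] card_mono[of "{3, 4, 5 :: nat}" B]
    by (auto simp: A_def B_def C_def)
  have "e \<in> (\<lambda>(i, j). {i, j}) ` (A \<times> B) \<union> (\<lambda>j. {0, j}) ` C" if "e \<in> edges H" for e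
  proof -
    have "e \<subseteq> verts H" "e \<in> edges (K33_pendant n)"
      using H that by (auto simp: subgraph_def simple_graph_def)
    then show ?thesis
      by (auto simp: K33_pendant_def edges_K33 A_def B_def C_def)
  qed
  then have "card (edges H) \<le> card ((\<lambda>(i, j). {i, j}) ` (A \<times> B) \<union> (\<lambda>j. {0, j}) ` C)"
    using A B C by (intro card_mono) auto
  also have "\<dots> \<le> card ((\<lambda>(i, j). {i, j}) ` (A \<times> B)) + card ((\<lambda>j. {0, j}) ` C)"
    by (rule card_Un_le)
  also have "\<dots> \<le> card (A \<times> B) + card C"
    using A B C by (intro add_mono card_image_le) auto
  finally have "card (edges H) \<le> card A * card B + card C"
    by (simp add: card_cartesian_product)
  \<comment> \<open>Adding these linear bounds gives 2ab \<le> 3a + 3b, hence 2(ab + c) \<le> 3(a +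
    b + c).\<close>
  moreover have "card A * card B \<le> card A * 3" "card A * card B \<le> 3 * card B"
    using A B by (auto intro: mult_le_mono)
  moreover have "card A + card B + card C \<le> card (verts H)"
  proof -
    have "card A + card B + card C = card (A \<union> B \<union> C)"
      using A B C by (subst card_Un_disjoint; (subst card_Un_disjoint)?) (auto simp: A_def B_def C_def)
    also have "\<dots> \<le> card (verts H)"
      using H by (intro card_mono) (auto simp: subgraph_def simple_graph_def A_def B_def C_def)
    finally show ?thesis .
  qed
  ultimately have "2 * card (edges H) \<le> 3 * card (verts H)" by linarith
  then show "2 * real (card (edges H)) \<le> 3 * real (card (verts H))" by linarith
qed

lemma lc_K33_pendant: "5 \<le> lc (K33_pendant n)"
proof (rule lc_ge)
  show "linear_coloring (K33_pendant n) (7 + n) id"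
    by (rule linear_coloring_id[OF simple_K33_pendant]) (simp add: K33_pendant_def)
  have E: "{a, b} \<in> edges (K33_pendant n)" if "a \<in> {0, 1, 2}" "b \<in> {3, 4, 5}" for a b
  proof -
    have "(a, b) \<in> {0, 1, 2} \<times> {3, 4, 5}" using that by blast
    from imageI[OF this, of "\<lambda>(i, j). {i, j}"] show ?thesis
      unfolding K33_pendant_def edges_K33 by simp
  qed
  show "5 \<le> k" if "linear_coloring (K33_pendant n) k c" for k c
    by (rule linear_coloring_K33_ge_5[where A = "{0, 1, 2}" and B = "{3, 4, 5}", OF that _ _ _ E])
       (auto simp: K33_pendant_def)
qed

theorem mainTheorem2:
  "\<exists>F :: nat graph set.
     infinite F \<and>
     pairwise (\<lambda>G H. \<not> isomorphic G H) F \<and>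
     (\<forall>G \<in> F.
        simple_graph G \<and>
        contains_subgraph G (complete_bipartite 3 3) \<and>
        mad G = 3 \<and>
        max_degree G = 4 \<and>
        int (lc G) > \<lceil>real (max_degree G) / 2\<rceil> + 2)"
proof (rule exI[of _ "range K33_pendant"], intro conjI ballI)
  have card: "card (verts (K33_pendant n)) = 7 + n" for n by (simp add: K33_pendant_def)
  \<comment> \<open>The order \<open>7 + n\<close> determines \<open>n\<close>; the same invariant
    separates isomorphism classes below.\<close>
  have "inj K33_pendant" by (rule injI) (metis card add_left_cancel)
  then show "infinite (range K33_pendant)" by (simp add: finite_image_iff)
  show "pairwise (\<lambda>G H. \<not> isomorphic G H) (range K33_pendant)"
    by (auto simp: pairwise_def card dest!: isomorphic_card_verts)
  fix G assume "G \<in> range K33_pendant"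
  then obtain n where G: "G = K33_pendant n" by blast
  show "simple_graph G" "mad G = 3" "max_degree G = 4"
    unfolding G by (rule simple_K33_pendant mad_K33_pendant max_degree_K33_pendant)+
  show "contains_subgraph G (complete_bipartite 3 3)"
    unfolding contains_subgraph_def G using subgraph_K33_pendant isomorphic_refl by blast
  \<comment> \<open>The right-hand side is 4 / 2 + 2 = 4, and five colors are necessary.\<close>
  show "int (lc G) > \<lceil>real (max_degree G) / 2\<rceil> + 2"
    using lc_K33_pendant[of n] unfolding G max_degree_K33_pendant by simp
qed

end
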